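(* Let $\lambda>-\tfrac12$, $\lambda\neq 0$, let $q>0$ be real, and let $\check{\mathbb{C}}_j^{(\lambda)}(x)$ denote the shifted monic ultraspherical polynomial of degree $j$ on $[0,1]$. Then for every integer $j\ge\lceil q\rceil$ and $x\in[0,1]$, the Caputo fractional derivative of order $q$ of $\check{\mathbb{C}}_j^{(\lambda)}$ is $$D^q\,\check{\mathbb{C}}_j^{(\lambda)}(x)=\mathcal{H}_j\sum_{r=0}^{\lfloor (j-q)/2\rfloor}\ \sum_{k=\lceil q\rceil}^{j-2r}(-1)^{j-r-k}\,\frac{\Gamma(j-r+\lambda)}{\Gamma(\lambda)\,\Gamma(r+1)}\,\frac{2^{\,j-2r+k}}{\Gamma(k-q+1)\,\Gamma(j-2r-k+1)}\,x^{k-q},$$ where $\mathcal{H}_j=2^{-2j}\,\dfrac{\Gamma(\lambda)\,j!}{\Gamma(j+\lambda)}$.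
   Context: The shifted monic ultraspherical polynomial of degree $j$ (with $j\ge 0$ an integer) and parameter $\lambda$ on $[0,1]$ is $$\check{\mathbb{C}}_j^{(\lambda)}(x)=\mathcal{H}_j\sum_{r=0}^{\lfloor j/2\rfloor}\sum_{k=0}^{j-2r}(-1)^{j-r-k}\,\frac{\Gamma(j-r+\lambda)}{\Gamma(\lambda)\,\Gamma(r+1)}\,\frac{2^{\,j-2r+k}}{\Gamma(k+1)\,\Gamma(j-2r-k+1)}\,x^k,\qquad \mathcal{H}_j=2^{-2j}\,\frac{\Gamma(\lambda)\,j!}{\Gamma(j+\lambda)}.$$ The Caputo fractional derivative $D^q$ of order $q>0$ is a linear operator; on polynomials it is determined by linearity and its action on monomials $x^k$, $k\in\{0,1,2,\dots\}$: $$D^q x^k=\begin{cases}0, & k<\lceil q\rceil,\\[2pt] \dfrac{\Gamma(k+1)}{\Gamma(k+1-q)}\,x^{k-q}, & k\ge\lceil q\rceil.\end{cases}$$ Here $\lceil q\rceil$ is the smallest integer greater than or equal to $q$, $\lfloor\cdot\rfloor$ is the integer part, and $x^0=1$ (including at $x=0$). *)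

theory Defs
  imports "HOL-Analysis.Analysis" "HOL-Computational_Algebra.Polynomial"
begin

definition ultraspherical_factor :: "real \<Rightarrow> nat \<Rightarrow> real" where
  "ultraspherical_factor lam j = 2 powi (- 2 * int j) * (Gamma lam * fact j / Gamma (real j + lam))"

(* The truncated subtractions on nat below are exact, since 2 r \<le> j and k \<le> j - 2 r. *)
definition shifted_monic_ultraspherical :: "real \<Rightarrow> nat \<Rightarrow> real poly" where
  "shifted_monic_ultraspherical lam j =
     smult (ultraspherical_factor lam j)
       (\<Sum>r = 0..j div 2. \<Sum>k = 0..j - 2 * r.
          monom ((- 1) ^ (j - r - k)
                 * (Gamma (real j - real r + lam) / (Gamma lam * Gamma (real r + 1)))
                 * (2 ^ (j - 2 * r + k)
                    / (Gamma (real k + 1) * Gamma (real j - 2 * real r - real k + 1)))) k)"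

(* Real exponent with the convention x^0 = 1 also at x = 0; in the library 0 powr 0 = 0. *)
definition rpow :: "real \<Rightarrow> real \<Rightarrow> real" where
  "rpow x a = (if a = 0 then 1 else x powr a)"

definition caputo_monomial :: "real \<Rightarrow> nat \<Rightarrow> real \<Rightarrow> real" where
  "caputo_monomial q k x =
     (if int k < \<lceil>q\<rceil> then 0
      else Gamma (real k + 1) / Gamma (real k + 1 - q) * rpow x (real k - q))"

(* The Caputo derivative on polynomials: the linear extension of its action on monomials
   (see caputo_monom, caputo_add and caputo_smult). Its values are functions, as the
   exponents k - q need not be integers. *)
definition caputo :: "real \<Rightarrow> real poly \<Rightarrow> real \<Rightarrow> real" where
  "caputo q p x = (\<Sum>k\<le>degree p. coeff p k * caputo_monomial q k x)"

lemma caputo_bound: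
  assumes "degree p \<le> n"
  shows "caputo q p x = (\<Sum>k\<le>n. coeff p k * caputo_monomial q k x)"
  unfolding caputo_def
  by (rule sum.mono_neutral_left) (use assms in \<open>auto simp: coeff_eq_0\<close>)

lemma caputo_monom: "caputo q (monom 1 k) x = caputo_monomial q k x"
  by (simp add: caputo_bound[where n = k] degree_monom_le if_distribR
      if_distrib[where f = "\<lambda>c. c * _"] cong: if_cong)

lemma caputo_add: "caputo q (p + p') x = caputo q p x + caputo q p' x"
proof -
  let ?n = "max (degree p) (degree p')"
  have "degree (p + p') \<le> ?n"
    by (rule degree_add_le_max)
  then show ?thesis
    by (simp add: caputo_bound[where n = ?n] sum.distrib[symmetric] distrib_right)
qed

lemma caputo_smult: "caputo q (smult c p) x = c * caputo q p x"
  by (subst caputo_bound[where n = "degree p"])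
     (auto simp: caputo_def sum_distrib_left mult.assoc degree_smult_le)

end

(* The Caputo derivative kills the powers below \<lceil>q\<rceil>, so the sum for r runs over
   \<lceil>q\<rceil> \<le> k \<le> j - 2 r. If r exceeds (j - q) / 2 this range is empty, which shortens
   the outer sum. *)
theory Submission
  imports Defs
begin

lemma caputo_0: "caputo q 0 x = 0"
  by (simp add: caputo_def)

lemma caputo_sum: "caputo q (\<Sum>i\<in>A. p i) x = (\<Sum>i\<in>A. caputo q (p i) x)"
  by (induction A rule: infinite_finite_induct) (simp_all add: caputo_0 caputo_add)

lemma caputo_monom_coeff: "caputo q (monom c k) x = c * caputo_monomial q k x"
  using caputo_smult[of q c "monom 1 k" x] by (simp add: smult_monom caputo_monom)

text \<open>Since \<open>r\<close> is an integer, exceeding the floor means exceeding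
  \<open>(j - q) / 2\<close> itself, so \<open>j - 2 r < q \<le> \<lceil>q\<rceil>\<close>. The
  bound \<open>2 * r \<le> j\<close> makes the truncated subtraction exact.\<close>

lemma less_ceiling_if_floor_half_less:
  fixes q :: real and j r :: nat
  assumes "\<lfloor>(real j - q) / 2\<rfloor> < int r" "2 * r \<le> j"
  shows "j - 2 * r < nat \<lceil>q\<rceil>"
proof -
  have "(real j - q) / 2 < real r"
    using assms(1) by (simp add: floor_less_iff)
  then have "real (j - 2 * r) < q"
    using assms(2) by (simp add: of_nat_diff)
  then show ?thesis by linarith
qed

theorem theorem3p2:
  fixes lam q x :: real and j :: nat
  assumes "lam > - 1 / 2" and "lam \<noteq> 0" and "q > 0"
    and "int j \<ge> \<lceil>q\<rceil>" and "x \<in> {0..1}"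
  shows "caputo q (shifted_monic_ultraspherical lam j) x =
    ultraspherical_factor lam j *
      (\<Sum>r = 0..nat \<lfloor>(real j - q) / 2\<rfloor>. \<Sum>k = nat \<lceil>q\<rceil>..j - 2 * r.
         (- 1) ^ (j - r - k)
         * (Gamma (real j - real r + lam) / (Gamma lam * Gamma (real r + 1)))
         * (2 ^ (j - 2 * r + k)
            / (Gamma (real k - q + 1) * Gamma (real j - 2 * real r - real k + 1)))
         * rpow x (real k - q))"
proof -
  \<comment> \<open>\<open>c r k\<close> is only a coefficient of the polynomial, whereas
    \<open>d r k\<close> is a whole summand of the claim, power of \<open>x\<close>
    included.\<close>
  define c where "c r k = (- 1) ^ (j - r - k)
      * (Gamma (real j - real r + lam) / (Gamma lam * Gamma (real r + 1)))
      * (2 ^ (j - 2 * r + k)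
         / (Gamma (real k + 1) * Gamma (real j - 2 * real r - real k + 1)))" for r k
  define d where "d r k = (- 1) ^ (j - r - k)
      * (Gamma (real j - real r + lam) / (Gamma lam * Gamma (real r + 1)))
      * (2 ^ (j - 2 * r + k)
         / (Gamma (real k - q + 1) * Gamma (real j - 2 * real r - real k + 1)))
      * rpow x (real k - q)" for r k
  have low: "c r k * caputo_monomial q k x = 0" if "k < nat \<lceil>q\<rceil>" for r k
    using that by (simp add: caputo_monomial_def zless_nat_eq_int_zless)
  have high: "c r k * caputo_monomial q k x = d r k" if "nat \<lceil>q\<rceil> \<le> k" for r k
  proof -
    \<comment> \<open>The factor \<open>Gamma (real k + 1)\<close> produced by differentiation
      cancels the one in the denominator of \<open>c r k\<close>; the other Gamma arguments only
      have to be brought to the same form.\<close>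
    have "Gamma (real k + 1) \<noteq> 0"
      by (simp add: Gamma_real_pos less_imp_neq[symmetric])
    moreover have "\<not> int k < \<lceil>q\<rceil>" using that by linarith
    moreover have "real k + 1 - q = real k - q + 1" by simp
    ultimately show ?thesis
      by (simp only: c_def d_def caputo_monomial_def if_False) (simp add: mult_ac)
  qed
  \<comment> \<open>This includes \<open>n < nat \<lceil>q\<rceil>\<close>, where every term on the
    left vanishes and the right-hand sum is empty.\<close>
  have inner: "(\<Sum>k = 0..n. c r k * caputo_monomial q k x) = (\<Sum>k = nat \<lceil>q\<rceil>..n. d r k)" for n r
  proof (rule sum.mono_neutral_cong_right)
    show "\<forall>k \<in> {0..n} - {nat \<lceil>q\<rceil>..n}. c r k * caputo_monomial q k x = 0"
      by (intro ballI low) (auto simp: not_le simp del: nat_ceiling_le_eq)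
  qed (simp_all add: high del: nat_ceiling_le_eq)
  \<comment> \<open>From \<open>q \<le> \<lceil>q\<rceil> \<le> j\<close>; hence \<open>nat\<close>
    does not truncate the upper limit of the outer sum.\<close>
  have floor_nonneg: "0 \<le> \<lfloor>(real j - q) / 2\<rfloor>"
    using assms(4) by (simp add: ceiling_le_iff)
  \<comment> \<open>As \<open>q > 0\<close>, twice the floor is at most \<open>j\<close>. Stated
    between integers, this bounds the floor by \<open>j div 2\<close>.\<close>
  have "real_of_int \<lfloor>(real j - q) / 2\<rfloor> \<le> (real j - q) / 2"
    by (rule of_int_floor_le)
  then have "real_of_int (2 * \<lfloor>(real j - q) / 2\<rfloor>) \<le> real_of_int (int j)"
    using assms(3) by simp
  then have "2 * \<lfloor>(real j - q) / 2\<rfloor> \<le> int j"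
    by (simp only: of_int_le_iff)
  then have subset: "{0..nat \<lfloor>(real j - q) / 2\<rfloor>} \<subseteq> {0..j div 2}"
    using floor_nonneg by (intro atLeastatMost_subset_iff[THEN iffD2]) linarith
  have "caputo q (shifted_monic_ultraspherical lam j) x = ultraspherical_factor lam j *
      (\<Sum>r = 0..j div 2. \<Sum>k = 0..j - 2 * r. c r k * caputo_monomial q k x)"
    unfolding shifted_monic_ultraspherical_def c_def
    by (simp only: caputo_smult caputo_sum caputo_monom_coeff)
  also have "\<dots> = ultraspherical_factor lam j *
      (\<Sum>r = 0..j div 2. \<Sum>k = nat \<lceil>q\<rceil>..j - 2 * r. d r k)"
    by (simp only: inner)
  also have "(\<Sum>r = 0..j div 2. \<Sum>k = nat \<lceil>q\<rceil>..j - 2 * r. d r k)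
      = (\<Sum>r = 0..nat \<lfloor>(real j - q) / 2\<rfloor>. \<Sum>k = nat \<lceil>q\<rceil>..j - 2 * r. d r k)"
  proof (rule sum.mono_neutral_right[OF _ subset], simp, intro ballI)
    fix r assume r: "r \<in> {0..j div 2} - {0..nat \<lfloor>(real j - q) / 2\<rfloor>}"
    \<comment> \<open>Membership in \<open>{0..j div 2}\<close> supplies
      \<open>2 * r \<le> j\<close>, and lying outside the shorter range supplies the floor
      inequality.\<close>
    have "j - 2 * r < nat \<lceil>q\<rceil>"
      by (rule less_ceiling_if_floor_half_less) (use r in auto)
    then show "(\<Sum>k = nat \<lceil>q\<rceil>..j - 2 * r. d r k) = 0"
      by simp
  qed
  finally show ?thesis
    unfolding d_def .
qed

end
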